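(* Let $(\Omega, \mathcal{F}, \mu)$ be a probability space. Let $1 \leq r, p_1, p_2, q_1, q_2 \leq \infty$ satisfy $\frac{1}{r} = \frac{1}{p_1} + \frac{1}{q_1} = \frac{1}{p_2} + \frac{1}{q_2}$. Then for any real-valued $f, g \in L^\infty(\Omega, \mu)$, one has $$\|fg - \mathbb{E}(fg)\|_r \leq \|f\|_{p_1} \|g - \mathbb{E}g\|_{q_1} + \|g\|_{p_2} \|f - \mathbb{E}f\|_{q_2}.$$
   Context: Here $\|\cdot\|_p$ denotes the usual norm of $L^p(\Omega,\mu)$ (the essential supremum norm if $p = \infty$), $\mathbb{E}f = \int_\Omega f \, d\mu$, and the convention $1/\infty = 0$ is used. *)

theory Defs
  imports "HOL-Probability.Probability"
begin

(* The norm takes values in [0, \<infinity>] and is infinite for measurable f outside L^p.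
   It is the usual norm only for exponents p \<ge> 1. *)
definition Lp_norm :: "'a measure \<Rightarrow> ennreal \<Rightarrow> ('a \<Rightarrow> real) \<Rightarrow> ennreal" where
  "Lp_norm M p f =
    (if p = \<infinity> then esssup M (\<lambda>x. ennreal \<bar>f x\<bar>)
     else let I = (\<integral>\<^sup>+ x. ennreal (\<bar>f x\<bar> powr enn2real p) \<partial>M)
          in if I = \<infinity> then \<infinity> else ennreal (enn2real I powr (1 / enn2real p)))"

(* Representatives: functions are not identified when they agree almost everywhere. *)
definition Lp_space :: "'a measure \<Rightarrow> ennreal \<Rightarrow> ('a \<Rightarrow> real) set" where
  "Lp_space M p = {f \<in> borel_measurable M. Lp_norm M p f < \<infinity>}"

end

theory Submission
  imports Defs
begin

text \<open>
  With \<open>K f h x y = ((f x + f y) * h x + (f x - f y) * h y) / 2\<close>, integrating the symmetrized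
  product rule for \<open>f x * g x - f y * g y\<close> over \<open>y\<close> writes \<open>f g - E (f g)\<close> as the sum of the
  integrals over \<open>y\<close> of \<open>K f (g - E g) x y\<close> and \<open>K g (f - E f) x y\<close>; the terms in \<open>h y\<close> make up
  for the fact that centering is not a contraction. By Minkowski it remains to bound the \<open>r\<close>-norm
  of \<open>\<integral>y. K f h x y\<close> by the \<open>p\<close>-norm of \<open>f\<close> times the \<open>q\<close>-norm of \<open>h\<close>. Jensen's inequality and
  the symmetry between \<open>x\<close> and \<open>y\<close> reduce this to a pointwise bound for
  \<open>\<bar>K f h x y\<bar>\<^sup>r + \<bar>K f h y x\<bar>\<^sup>r\<close>, which follows from a majorization and Young's inequality.
\<close>

section \<open>Convexity of powers and two-point majorization\<close>

text \<open>If \<open>x\<close> or \<open>y\<close> is 0, the claim reduces to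
  \<open>w powr R\<close> <= \<open>w\<close> for a weight \<open>w\<close> in [0, 1]; for positive
  arguments it is the convexity of the power function.\<close>

lemma powr_convex_nonneg:
  fixes R x y u v :: real
  assumes "1 \<le> R" "0 \<le> x" "0 \<le> y" "0 \<le> u" "0 \<le> v" "u + v = 1"
  shows "(u * x + v * y) powr R \<le> u * x powr R + v * y powr R"
proof -
  have scale: "(w * z) powr R \<le> w * z powr R" if "0 \<le> w" "w \<le> 1" "0 \<le> z" for w z :: real
  proof -
    have "w powr R \<le> w"
      using powr_mono'[of 1 R w] that assms(1) by simp
    then show ?thesis
      using that by (auto simp: powr_mult intro: mult_right_mono)
  qed
  consider "x = 0" | "y = 0" | "0 < x" "0 < y" using assms by linarith
  then show ?thesis
  proof cases
    case 3
    have u: "u = 1 - v" using assms by simp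
    show ?thesis
      using convex_onD[OF powr_convex[OF assms(1)], of v x y] assms 3 unfolding u by simp
  qed (use scale assms in auto)
qed

lemma convex_on_abs_powr:
  assumes "1 \<le> (R :: real)"
  shows "convex_on UNIV (\<lambda>x :: real. \<bar>x\<bar> powr R)"
proof (rule convex_onI)
  fix t x y :: real
  assume t: "0 < t" "t < 1"
  have "\<bar>(1 - t) * x + t * y\<bar> \<le> (1 - t) * \<bar>x\<bar> + t * \<bar>y\<bar>"
    using t abs_triangle_ineq[of "(1 - t) * x" "t * y"] by (simp add: abs_mult)
  then have "\<bar>(1 - t) * x + t * y\<bar> powr R \<le> ((1 - t) * \<bar>x\<bar> + t * \<bar>y\<bar>) powr R"
    using assms by (intro powr_mono2) auto
  also have "\<dots> \<le> (1 - t) * \<bar>x\<bar> powr R + t * \<bar>y\<bar> powr R"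
    using t assms by (intro powr_convex_nonneg) auto
  finally show "\<bar>(1 - t) *\<^sub>R x + t *\<^sub>R y\<bar> powr R \<le> (1 - t) * \<bar>x\<bar> powr R + t * \<bar>y\<bar> powr R"
    by simp
qed auto

text \<open>The two-point case of the Tomic-Weyl inequality. If \<open>y\<close> exceeds
  \<open>B\<close>, then \<open>y\<close> is a convex combination of \<open>A\<close> and
  \<open>B\<close>, and \<open>x\<close> is at most the combination with the two weights exchanged.
  Adding the two convexity bounds makes the weights disappear.\<close>

lemma powr_add_le_of_weakly_majorized:
  fixes R x y A B :: real
  assumes "1 \<le> R" "0 \<le> x" "0 \<le> y" "0 \<le> B" "x \<le> A" "y \<le> A" "x + y \<le> A + B"
  shows "x powr R + y powr R \<le> A powr R + B powr R"
proof (cases "y \<le> B")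
  case True
  then show ?thesis using assms by (intro add_mono powr_mono2) auto
next
  case False
  \<comment> \<open>This is the weight of \<open>A\<close> when \<open>y\<close> is written as a
    combination of \<open>A\<close> and \<open>B\<close>; the denominator is positive since
    \<open>B\<close> < \<open>y\<close> <= \<open>A\<close>.\<close>
  define t where "t = (y - B) / (A - B)"
  have t: "0 \<le> t" "t \<le> 1" "t * (A - B) = y - B"
    using False assms by (auto simp: t_def divide_simps)
  have y: "y = t * A + (1 - t) * B" using t(3) by (simp add: algebra_simps)
  have x: "x \<le> (1 - t) * A + t * B" using t(3) assms(7) by (simp add: algebra_simps)
  have A: "0 \<le> A" using assms by linarith
  have "x powr R \<le> ((1 - t) * A + t * B) powr R"
    using x assms by (intro powr_mono2) auto
  also have "\<dots> \<le> (1 - t) * A powr R + t * B powr R"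
    using t A assms by (intro powr_convex_nonneg) auto
  finally have 1: "x powr R \<le> (1 - t) * A powr R + t * B powr R" .
  have "y powr R \<le> t * A powr R + (1 - t) * B powr R"
    unfolding y using t A assms by (intro powr_convex_nonneg) auto
  with 1 show ?thesis by (simp add: algebra_simps)
qed

section \<open>The kernel and its pointwise bound\<close>

definition leibniz_kernel :: "('a \<Rightarrow> real) \<Rightarrow> ('a \<Rightarrow> real) \<Rightarrow> 'a \<Rightarrow> 'a \<Rightarrow> real" where
  "leibniz_kernel f h x y = ((f x + f y) * h x + (f x - f y) * h y) / 2"

text \<open>Rearrangement inequality for two pairs: the right side minus the left side is
  \<open>(a - b) * (u - v)\<close>.\<close>

lemma mult_cross_le:
  fixes a b u v :: real
  assumes "b \<le> a" "v \<le> u"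
  shows "a * v + b * u \<le> a * u + b * v"
  using mult_nonneg_nonneg[of "a - b" "u - v"] assms by (simp add: algebra_simps)

text \<open>The constant is 1 because |a + b| + |a - b| is twice the larger of |a| and |b|. The
  bound serves both as the top entry of the majorization and as the whole estimate for
  \<open>r = \<infinity>\<close>.\<close>

lemma half_sum_diff_le:
  fixes a b u v A U :: real
  assumes "\<bar>a\<bar> \<le> A" "\<bar>b\<bar> \<le> A" "\<bar>u\<bar> \<le> U" "\<bar>v\<bar> \<le> U"
  shows "\<bar>((a + b) * u + (a - b) * v) / 2\<bar> \<le> A * U"
proof -
  have "\<bar>(a + b) * u + (a - b) * v\<bar> \<le> \<bar>a + b\<bar> * \<bar>u\<bar> + \<bar>a - b\<bar> * \<bar>v\<bar>"
    using abs_triangle_ineq[of "(a + b) * u" "(a - b) * v"] by (simp add: abs_mult)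
  also have "\<dots> \<le> \<bar>a + b\<bar> * U + \<bar>a - b\<bar> * U"
    using assms by (intro add_mono mult_left_mono) auto
  also have "\<dots> = (\<bar>a + b\<bar> + \<bar>a - b\<bar>) * U" by (simp add: algebra_simps)
  also have "\<dots> \<le> (2 * A) * U"
    using assms by (intro mult_right_mono) auto
  finally show ?thesis by simp
qed

text \<open>The two values of the kernel have sum \<open>f y * h x + f x * h y\<close> and difference
  \<open>f x * h x - f y * h y\<close>. Hence they are weakly majorized by the products of the sorted
  values of \<open>\<bar>f\<bar>\<close> and \<open>\<bar>h\<bar>\<close>.\<close>
lemma leibniz_kernel_powr_le:
  assumes R: "1 \<le> R"
  shows "\<bar>leibniz_kernel f h x y\<bar> powr R + \<bar>leibniz_kernel f h y x\<bar> powr R \<le>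
    max ((\<bar>f x\<bar> * \<bar>h x\<bar>) powr R + (\<bar>f y\<bar> * \<bar>h y\<bar>) powr R)
        ((\<bar>f x\<bar> * \<bar>h y\<bar>) powr R + (\<bar>f y\<bar> * \<bar>h x\<bar>) powr R)"
proof -
  let ?k = "leibniz_kernel f h x y" and ?l = "leibniz_kernel f h y x"
  define A B where "A = max \<bar>f x\<bar> \<bar>f y\<bar>" and "B = min \<bar>f x\<bar> \<bar>f y\<bar>"
  define U V where "U = max \<bar>h x\<bar> \<bar>h y\<bar>" and "V = min \<bar>h x\<bar> \<bar>h y\<bar>"
  note defs = A_def B_def U_def V_def
  have "?k + ?l = f y * h x + f x * h y" "?k - ?l = f x * h x - f y * h y"
    unfolding leibniz_kernel_def by (simp_all add: field_simps)
  then have "\<bar>?k + ?l\<bar> \<le> \<bar>f y\<bar> * \<bar>h x\<bar> + \<bar>f x\<bar> * \<bar>h y\<bar>"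
    "\<bar>?k - ?l\<bar> \<le> \<bar>f x\<bar> * \<bar>h x\<bar> + \<bar>f y\<bar> * \<bar>h y\<bar>"
    using abs_triangle_ineq[of "f y * h x" "f x * h y"]
      abs_triangle_ineq4[of "f x * h x" "f y * h y"] by (simp_all add: abs_mult)
  \<comment> \<open>By rearrangement, the sorted pairing dominates both the aligned and the crossed
    pairing.\<close>
  moreover have "\<bar>f y\<bar> * \<bar>h x\<bar> + \<bar>f x\<bar> * \<bar>h y\<bar> \<le> A * U + B * V"
    "\<bar>f x\<bar> * \<bar>h x\<bar> + \<bar>f y\<bar> * \<bar>h y\<bar> \<le> A * U + B * V"
    using mult_cross_le[of B A V U] unfolding defs by (auto simp: max_def min_def algebra_simps)
  ultimately have "\<bar>?k\<bar> + \<bar>?l\<bar> \<le> A * U + B * V" by linarith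
  moreover have "\<bar>?k\<bar> \<le> A * U" "\<bar>?l\<bar> \<le> A * U"
    unfolding leibniz_kernel_def by (rule half_sum_diff_le; simp add: defs)+
  moreover have "0 \<le> B * V" by (simp add: defs)
  ultimately have "\<bar>?k\<bar> powr R + \<bar>?l\<bar> powr R \<le> (A * U) powr R + (B * V) powr R"
    using R by (intro powr_add_le_of_weakly_majorized) auto
  \<comment> \<open>The sorted pairing is the aligned one if |f| and |h| order \<open>x\<close> and
    \<open>y\<close> in the same way, and the crossed one otherwise.\<close>
  also have "\<dots> \<le> max ((\<bar>f x\<bar> * \<bar>h x\<bar>) powr R + (\<bar>f y\<bar> * \<bar>h y\<bar>) powr R)
        ((\<bar>f x\<bar> * \<bar>h y\<bar>) powr R + (\<bar>f y\<bar> * \<bar>h x\<bar>) powr R)"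
    unfolding defs by (cases "\<bar>f x\<bar> \<le> \<bar>f y\<bar>"; cases "\<bar>h x\<bar> \<le> \<bar>h y\<bar>")
      (simp_all add: max_absorb1 max_absorb2 min_absorb1 min_absorb2 le_max_iff_disj add.commute)
  finally show ?thesis .
qed

section \<open>Norm bounds, Minkowski's and Jensen's inequalities\<close>

text \<open>Homogeneity turns a bound on the norm into a bound on an integral of powers, so that
  later estimates take no roots and need not treat an infinite integral separately.\<close>

lemma Lp_norm_finite_le_iff:
  assumes P: "1 \<le> P" and c: "0 < c" and [measurable]: "f \<in> borel_measurable M"
  shows "Lp_norm M (ennreal P) f \<le> ennreal c \<longleftrightarrow>
    (\<integral>\<^sup>+ x. ennreal (\<bar>f x / c\<bar> powr P) \<partial>M) \<le> 1"
proof -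
  let ?I = "\<integral>\<^sup>+ x. ennreal (\<bar>f x\<bar> powr P) \<partial>M"
  have "(\<integral>\<^sup>+ x. ennreal (\<bar>f x / c\<bar> powr P) \<partial>M) = (\<integral>\<^sup>+ x. ennreal (1 / c powr P) * ennreal (\<bar>f x\<bar> powr P) \<partial>M)"
    using c by (intro nn_integral_cong) (simp add: abs_divide powr_divide ennreal_mult[symmetric])
  also have "\<dots> = ennreal (1 / c powr P) * ?I"
    by (rule nn_integral_cmult) simp
  finally have eq: "(\<integral>\<^sup>+ x. ennreal (\<bar>f x / c\<bar> powr P) \<partial>M) = ennreal (1 / c powr P) * ?I" .
  show ?thesis
  proof (cases ?I)
    case top
    \<comment> \<open>Both sides of the equivalence are false here.\<close>
    then show ?thesis using P c unfolding eq by (simp add: Lp_norm_def ennreal_mult_top top_unique)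
  next
    case (real i)
    have "i powr (1 / P) \<le> c \<longleftrightarrow> (i powr (1 / P)) powr P \<le> c powr P"
      using P c powr_mono2[of P "i powr (1 / P)" c] powr_less_mono2[of P c "i powr (1 / P)"] by force
    also have "(i powr (1 / P)) powr P = i" using real P by (simp add: powr_powr)
    finally show ?thesis
      using real P c unfolding eq
      by (simp add: Lp_norm_def ennreal_mult[symmetric] divide_simps ennreal_le_1 flip: ennreal_1)
  qed
qed

lemma Lp_norm_infinity_le_iff:
  assumes c: "0 \<le> c" and [measurable]: "f \<in> borel_measurable M"
  shows "Lp_norm M \<infinity> f \<le> ennreal c \<longleftrightarrow> (AE x in M. \<bar>f x\<bar> \<le> c)"
proof
  assume "Lp_norm M \<infinity> f \<le> ennreal c"
  then have "esssup M (\<lambda>x. ennreal \<bar>f x\<bar>) \<le> ennreal c" by (simp add: Lp_norm_def)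
  with esssup_AE[of "\<lambda>x. ennreal \<bar>f x\<bar>" M] show "AE x in M. \<bar>f x\<bar> \<le> c"
    using c by (auto elim!: eventually_mono dest: order_trans)
next
  assume "AE x in M. \<bar>f x\<bar> \<le> c"
  then show "Lp_norm M \<infinity> f \<le> ennreal c"
    using c by (auto simp: Lp_norm_def intro!: esssup_I elim!: eventually_mono)
qed


lemma ennreal_ge_1_cases:
  assumes "1 \<le> (p :: ennreal)"
  obtains "p = \<infinity>" "1 / p = 0" | P where "1 \<le> P" "p = ennreal P" "1 / p = ennreal (1 / P)"
proof (cases p)
  case (real P)
  then have "1 \<le> P" using assms by (simp flip: ennreal_1)
  moreover have "1 / p = ennreal (1 / P)"
    using real \<open>1 \<le> P\<close> divide_ennreal[of 1 P] by simp
  ultimately show ?thesis using real that by blast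
qed (use that in simp)

lemma Lp_norm_le_iff_scaled:
  assumes "1 \<le> p" and c: "0 < c" and [measurable]: "f \<in> borel_measurable M"
  shows "Lp_norm M p f \<le> ennreal c \<longleftrightarrow> Lp_norm M p (\<lambda>x. f x / c) \<le> 1"
  using assms(1)
proof (cases rule: ennreal_ge_1_cases)
  case 1
  then show ?thesis
    using c Lp_norm_infinity_le_iff[of c f M] Lp_norm_infinity_le_iff[of 1 "\<lambda>x. f x / c" M]
    by (simp add: abs_divide)
next
  case (2 P)
  then show ?thesis
    using c Lp_norm_finite_le_iff[of P c f M] Lp_norm_finite_le_iff[of P 1 "\<lambda>x. f x / c" M]
    by simp
qed

text \<open>Minkowski's inequality from convexity of the unit ball:
  \<open>(f x + g x) / (a + b)\<close> is the convex combination of \<open>f x / a\<close> and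
  \<open>g x / b\<close> with weights \<open>a / (a + b)\<close> and \<open>b / (a + b)\<close>.
  Bounds by positive reals in place of the norms keep the divisions meaningful.\<close>

lemma Lp_norm_add_le:
  assumes "1 \<le> p" and ab: "0 < a" "0 < b"
    and [measurable]: "f \<in> borel_measurable M" "g \<in> borel_measurable M"
    and le: "Lp_norm M p f \<le> ennreal a" "Lp_norm M p g \<le> ennreal b"
  shows "Lp_norm M p (\<lambda>x. f x + g x) \<le> ennreal (a + b)"
  using assms(1)
proof (cases rule: ennreal_ge_1_cases)
  case 1
  show ?thesis
  proof -
    have "AE x in M. \<bar>f x\<bar> \<le> a" "AE x in M. \<bar>g x\<bar> \<le> b"
      using 1 ab le Lp_norm_infinity_le_iff[of a f M] Lp_norm_infinity_le_iff[of b g M] by simp_all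
    then have "AE x in M. \<bar>f x + g x\<bar> \<le> a + b"
      by eventually_elim linarith
    then show ?thesis
      using 1 ab Lp_norm_infinity_le_iff[of "a + b" "\<lambda>x. f x + g x" M] by simp
  qed
next
  case (2 P)
  define s where "s = a / (a + b)"
  have s: "0 \<le> s" "s \<le> 1" "1 - s = b / (a + b)" using ab by (auto simp: s_def field_simps)
  have "(\<integral>\<^sup>+ x. ennreal (\<bar>(f x + g x) / (a + b)\<bar> powr P) \<partial>M)
      \<le> (\<integral>\<^sup>+ x. ennreal s * ennreal (\<bar>f x / a\<bar> powr P) + ennreal (1 - s) * ennreal (\<bar>g x / b\<bar> powr P) \<partial>M)"
  proof (intro nn_integral_mono)
    fix x
    have "s * (f x / a) = f x / (a + b)" "(1 - s) * (g x / b) = g x / (a + b)"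
      unfolding s(3) using ab by (simp_all add: s_def)
    then have "(f x + g x) / (a + b) = (1 - (1 - s)) * (f x / a) + (1 - s) * (g x / b)"
      by (simp add: add_divide_distrib)
    then have "\<bar>(f x + g x) / (a + b)\<bar> powr P \<le> s * \<bar>f x / a\<bar> powr P + (1 - s) * \<bar>g x / b\<bar> powr P"
      using convex_onD[OF convex_on_abs_powr[OF 2(1)], of "1 - s" "f x / a" "g x / b"] s(1,2) by simp
    then show "ennreal (\<bar>(f x + g x) / (a + b)\<bar> powr P)
      \<le> ennreal s * ennreal (\<bar>f x / a\<bar> powr P) + ennreal (1 - s) * ennreal (\<bar>g x / b\<bar> powr P)"
      using s(1,2) by (simp add: ennreal_leI flip: ennreal_mult ennreal_plus)
  qed
  also have "\<dots> = ennreal s * (\<integral>\<^sup>+ x. ennreal (\<bar>f x / a\<bar> powr P) \<partial>M)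
      + ennreal (1 - s) * (\<integral>\<^sup>+ x. ennreal (\<bar>g x / b\<bar> powr P) \<partial>M)"
    by (simp add: nn_integral_add nn_integral_cmult)
  also have "\<dots> \<le> ennreal s * 1 + ennreal (1 - s) * 1"
    using le 2 ab by (intro add_mono mult_left_mono) (auto simp: Lp_norm_finite_le_iff)
  also have "\<dots> = 1" using s by (simp flip: ennreal_plus)
  finally show ?thesis
    using 2 ab Lp_norm_finite_le_iff[of P "a + b" "\<lambda>x. f x + g x" M] by simp
qed

lemma (in prob_space) Lp_norm_le_of_AE_bounded:
  assumes "1 \<le> p" "0 < c" and [measurable]: "f \<in> borel_measurable M"
    and bnd: "AE x in M. \<bar>f x\<bar> \<le> c"
  shows "Lp_norm M p f \<le> ennreal c"
  using assms(1)
proof (cases rule: ennreal_ge_1_cases)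
  case 1
  then show ?thesis using assms Lp_norm_infinity_le_iff[of c f M] by simp
next
  case (2 P)
  have "(\<integral>\<^sup>+ x. ennreal (\<bar>f x / c\<bar> powr P) \<partial>M) \<le> (\<integral>\<^sup>+ x. 1 \<partial>M)"
    using bnd 2 assms(2)
    by (intro nn_integral_mono_AE, elim eventually_mono)
      (auto simp: abs_divide ennreal_le_1 intro!: powr_le1)
  then show ?thesis using 2 assms(2) by (simp add: Lp_norm_finite_le_iff emeasure_space_1)
qed

lemma (in prob_space) expectation_powr_le_nn_integral:
  assumes R: "1 \<le> R" and X: "integrable M X"
  shows "ennreal (\<bar>expectation X\<bar> powr R) \<le> (\<integral>\<^sup>+ x. ennreal (\<bar>X x\<bar> powr R) \<partial>M)"
proof (cases "integrable M (\<lambda>x. \<bar>X x\<bar> powr R)")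
  case True
  have "\<bar>expectation X\<bar> powr R \<le> expectation (\<lambda>x. \<bar>X x\<bar> powr R)"
    using jensens_inequality[OF X _ _ True convex_on_abs_powr[OF R]] by simp
  then show ?thesis
    using True by (simp add: nn_integral_eq_integral ennreal_leI)
next
  case False
  \<comment> \<open>Without integrability of the power the right side is infinite.\<close>
  then show ?thesis
    using borel_measurable_integrable[OF X] by (simp add: integrable_iff_bounded less_top[symmetric])
qed

section \<open>Young's inequality and the double integral of the kernel\<close>

text \<open>The exponent relation makes \<open>R / P\<close> and \<open>R / Q\<close> weights with
  sum 1, so this is the weighted inequality of arithmetic and geometric means for
  \<open>x powr P\<close> and \<open>y powr Q\<close>.\<close>

lemma mult_powr_le_Young:
  fixes P Q R x y :: real
  assumes "1 \<le> P" "1 \<le> Q" "1 \<le> R" "1 / R = 1 / P + 1 / Q" "0 \<le> x" "0 \<le> y"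
  shows "(x * y) powr R \<le> R / P * x powr P + R / Q * y powr Q"
proof (cases "x = 0 \<or> y = 0")
  case True
  then show ?thesis using assms by auto
next
  case False
  have "R / P + R / Q = R * (1 / P + 1 / Q)" by (simp add: algebra_simps)
  also have "\<dots> = 1" using assms(3) by (simp flip: assms(4))
  finally have "(x powr P) powr (R / P) * (y powr Q) powr (R / Q) \<le> R / P * x powr P + R / Q * y powr Q"
    using False assms by (intro Youngs_inequality_0) auto
  then show ?thesis using assms by (simp add: powr_powr powr_mult)
qed

text \<open>The predicate \<open>S\<close> and the free choice of \<open>u\<close> and \<open>v\<close> cover infinite exponents, where
  Young's inequality degenerates to a bound outside a null set.\<close>
lemma (in prob_space) Young_majorant:
  assumes pqr: "1 \<le> p" "1 \<le> q" "1 \<le> R" "1 / ennreal R = 1 / p + 1 / q"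
    and [measurable]: "f \<in> borel_measurable M" "h \<in> borel_measurable M"
    and le: "Lp_norm M p f \<le> 1" "Lp_norm M q h \<le> 1"
  obtains S u v where "AE x in M. S x" "u \<in> borel_measurable M" "v \<in> borel_measurable M"
    "\<And>x. 0 \<le> u x" "\<And>x. 0 \<le> v x" "(\<integral>\<^sup>+ x. ennreal (u x + v x) \<partial>M) \<le> 1"
    "\<And>x y. S x \<Longrightarrow> S y \<Longrightarrow> (\<bar>f x\<bar> * \<bar>h y\<bar>) powr R \<le> u x + v y"
proof -
  have R: "1 / ennreal R = ennreal (1 / R)" using pqr(3) divide_ennreal[of 1 R] by simp
  from pqr(1) show ?thesis
  proof (cases rule: ennreal_ge_1_cases)
    case p: 1
    from pqr(2) show ?thesis
    proof (cases rule: ennreal_ge_1_cases)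
      case 1
      \<comment> \<open>Two infinite exponents would force \<open>1 / R\<close> to be 0, which is
        impossible for real \<open>R\<close>.\<close>
      then show ?thesis using p R pqr by simp
    next
      case (2 Q)
      \<comment> \<open>With \<open>p\<close> infinite, the choice is |f x| <= 1 for
        \<open>S x\<close>, zero for \<open>u\<close>, and the \<open>R\<close>-th power of |h| for
        \<open>v\<close>.\<close>
      then have "Q = R" using p R pqr by (simp add: field_simps)
      show ?thesis
      proof
        show "AE x in M. \<bar>f x\<bar> \<le> 1"
          using le(1) p Lp_norm_infinity_le_iff[of 1 f M] by simp
        show "(\<integral>\<^sup>+ x. ennreal (0 + \<bar>h x\<bar> powr R) \<partial>M) \<le> 1"
          using le(2) 2 \<open>Q = R\<close> Lp_norm_finite_le_iff[of R 1 h M] by simp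
        fix x y assume "\<bar>f x\<bar> \<le> 1" "\<bar>f y\<bar> \<le> 1"
        then show "(\<bar>f x\<bar> * \<bar>h y\<bar>) powr R \<le> 0 + \<bar>h y\<bar> powr R"
          using pqr by (auto intro!: powr_mono2 mult_left_le_one_le)
      qed auto
    qed
  next
    case p: (2 P)
    from pqr(2) show ?thesis
    proof (cases rule: ennreal_ge_1_cases)
      case 1
      then have "P = R" using p R pqr by (simp add: field_simps)
      show ?thesis
      proof
        show "AE x in M. \<bar>h x\<bar> \<le> 1"
          using le(2) 1 Lp_norm_infinity_le_iff[of 1 h M] by simp
        show "(\<integral>\<^sup>+ x. ennreal (\<bar>f x\<bar> powr R + 0) \<partial>M) \<le> 1"
          using le(1) p \<open>P = R\<close> Lp_norm_finite_le_iff[of R 1 f M] by simp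
        fix x y assume "\<bar>h x\<bar> \<le> 1" "\<bar>h y\<bar> \<le> 1"
        then show "(\<bar>f x\<bar> * \<bar>h y\<bar>) powr R \<le> \<bar>f x\<bar> powr R + 0"
          using pqr by (auto intro!: powr_mono2 mult_right_le_one_le)
      qed auto
    next
      case (2 Q)
      have eq: "1 / R = 1 / P + 1 / Q"
        using pqr R p 2 by (simp flip: ennreal_plus)
      have "R / P + R / Q = R * (1 / P + 1 / Q)" by (simp add: algebra_simps)
      also have "\<dots> = 1" using pqr(3) by (simp flip: eq)
      finally have sum: "R / P + R / Q = 1" .
      show ?thesis
      proof
        \<comment> \<open>With both exponents finite, Young's inequality holds at every point and no
          null set has to be removed.\<close>
        show "AE x in M. True" by simp
        have "(\<integral>\<^sup>+ x. ennreal (R / P * \<bar>f x\<bar> powr P + R / Q * \<bar>h x\<bar> powr Q) \<partial>M)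
          = (\<integral>\<^sup>+ x. ennreal (R / P) * ennreal (\<bar>f x\<bar> powr P) + ennreal (R / Q) * ennreal (\<bar>h x\<bar> powr Q) \<partial>M)"
          using pqr p 2 by (intro nn_integral_cong) (simp flip: ennreal_plus ennreal_mult)
        also have "\<dots> = ennreal (R / P) * (\<integral>\<^sup>+ x. ennreal (\<bar>f x\<bar> powr P) \<partial>M)
            + ennreal (R / Q) * (\<integral>\<^sup>+ x. ennreal (\<bar>h x\<bar> powr Q) \<partial>M)"
          by (simp add: nn_integral_add nn_integral_cmult)
        also have "\<dots> \<le> ennreal (R / P) * 1 + ennreal (R / Q) * 1"
          using le p 2 Lp_norm_finite_le_iff[of P 1 f M] Lp_norm_finite_le_iff[of Q 1 h M]
          by (intro add_mono mult_left_mono) auto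
        also have "\<dots> = 1"
          using sum pqr p 2 by (simp flip: ennreal_plus)
        finally show "(\<integral>\<^sup>+ x. ennreal (R / P * \<bar>f x\<bar> powr P + R / Q * \<bar>h x\<bar> powr Q) \<partial>M) \<le> 1" .
        show "(\<bar>f x\<bar> * \<bar>h y\<bar>) powr R \<le> R / P * \<bar>f x\<bar> powr P + R / Q * \<bar>h y\<bar> powr Q" for x y
          using mult_powr_le_Young[of P Q R] eq pqr p 2 by simp
      qed (use pqr p 2 in auto)
    qed
  qed
qed

lemma borel_measurable_leibniz_kernel [measurable (raw)]:
  assumes [measurable]: "f \<in> borel_measurable M" "h \<in> borel_measurable M"
    "a \<in> N \<rightarrow>\<^sub>M M" "b \<in> N \<rightarrow>\<^sub>M M"
  shows "(\<lambda>x. leibniz_kernel f h (a x) (b x)) \<in> borel_measurable N"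
  unfolding leibniz_kernel_def by measurable

text \<open>A single value of the kernel need not obey the required bound, only the sum of the
  values at (x, y) and (y, x) does. Exchanging the variables by Tonelli shows that the integral of
  this sum is twice the desired one, while its majorant \<open>?w x + ?w y\<close> has integral at
  most 2.\<close>

lemma (in prob_space) nn_integral_leibniz_kernel_powr_le_1:
  assumes pqr: "1 \<le> p" "1 \<le> q" "1 \<le> R" "1 / ennreal R = 1 / p + 1 / q"
    and [measurable]: "f \<in> borel_measurable M" "h \<in> borel_measurable M"
    and le: "Lp_norm M p f \<le> 1" "Lp_norm M q h \<le> 1"
  shows "(\<integral>\<^sup>+ x. \<integral>\<^sup>+ y. ennreal (\<bar>leibniz_kernel f h x y\<bar> powr R) \<partial>M \<partial>M) \<le> 1"
    (is "?A \<le> 1")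
proof -
  interpret MM: pair_prob_space M M ..
  obtain S u v where S: "AE x in M. S x"
    and [measurable]: "u \<in> borel_measurable M" "v \<in> borel_measurable M"
    and nonneg: "\<And>x. 0 \<le> u x" "\<And>x. 0 \<le> v x"
    and int: "(\<integral>\<^sup>+ x. ennreal (u x + v x) \<partial>M) \<le> 1"
    and bnd: "\<And>x y. S x \<Longrightarrow> S y \<Longrightarrow> (\<bar>f x\<bar> * \<bar>h y\<bar>) powr R \<le> u x + v y"
    by (rule Young_majorant[OF assms]) blast
  let ?k = "\<lambda>x y. ennreal (\<bar>leibniz_kernel f h x y\<bar> powr R)"
  let ?w = "\<lambda>x. ennreal (u x + v x)"
  have k: "?k x y + ?k y x \<le> ?w x + ?w y" if "S x" "S y" for x y
  proof -
    \<comment> \<open>Both alternatives of the maximum, aligned and crossed, have the same majorant,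
      because each uses \<open>u\<close> and \<open>v\<close> once at \<open>x\<close> and once at
      \<open>y\<close>.\<close>
    have "\<bar>leibniz_kernel f h x y\<bar> powr R + \<bar>leibniz_kernel f h y x\<bar> powr R \<le> (u x + v x) + (u y + v y)"
      using leibniz_kernel_powr_le[OF pqr(3), of f h x y] bnd[of x x] bnd[of y y] bnd[of x y] bnd[of y x] that
      by linarith
    then show ?thesis using nonneg by (simp add: ennreal_leI flip: ennreal_plus)
  qed
  have "?A + ?A = ?A + (\<integral>\<^sup>+ x. \<integral>\<^sup>+ y. ?k y x \<partial>M \<partial>M)"
    using MM.Fubini[of "\<lambda>(x, y). ?k x y"] by simp
  also have "\<dots> = (\<integral>\<^sup>+ x. \<integral>\<^sup>+ y. ?k x y + ?k y x \<partial>M \<partial>M)"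
    by (simp add: nn_integral_add cong: nn_integral_cong)
  also have "\<dots> \<le> (\<integral>\<^sup>+ x. \<integral>\<^sup>+ y. ?w x + ?w y \<partial>M \<partial>M)"
  proof (rule nn_integral_mono_AE)
    show "AE x in M. (\<integral>\<^sup>+ y. ?k x y + ?k y x \<partial>M) \<le> (\<integral>\<^sup>+ y. ?w x + ?w y \<partial>M)"
      using S
    proof eventually_elim
      case (elim x)
      show ?case
        using S by (intro nn_integral_mono_AE) (auto elim!: eventually_mono intro: k[OF elim])
    qed
  qed
  also have "\<dots> = (\<integral>\<^sup>+ x. ?w x \<partial>M) + (\<integral>\<^sup>+ x. ?w x \<partial>M)"
    by (simp add: nn_integral_add emeasure_space_1)
  also have "\<dots> \<le> 1 + 1" using int by (intro add_mono)
  finally have "2 * ?A \<le> 2 * 1" by (simp add: mult_2)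
  then show ?thesis by (subst (asm) ennreal_mult_le_mult_iff) auto
qed

section \<open>Integrating the kernel over its second variable\<close>

lemma integrable_leibniz_kernel:
  assumes "integrable M f" "integrable M h" "integrable M (\<lambda>x. f x * h x)" "finite_measure M"
  shows "integrable M (leibniz_kernel f h x)"
proof -
  interpret finite_measure M by fact
  have "leibniz_kernel f h x = (\<lambda>y. (f x * h x + f y * h x + (f x * h y - f y * h y)) / 2)"
    by (auto simp: leibniz_kernel_def algebra_simps)
  then show ?thesis using assms by simp
qed

lemma (in prob_space) integral_leibniz_kernel:
  assumes [simp]: "integrable M f" "integrable M h" "integrable M (\<lambda>x. f x * h x)"
  shows "(\<integral>y. leibniz_kernel f h x y \<partial>M) =
    ((f x + expectation f) * h x + (f x * expectation h - expectation (\<lambda>y. f y * h y))) / 2"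
proof -
  have "leibniz_kernel f h x = (\<lambda>y. (f x * h x + f y * h x + (f x * h y - f y * h y)) / 2)"
    by (auto simp: leibniz_kernel_def algebra_simps)
  then show ?thesis by (simp add: prob_space algebra_simps)
qed

text \<open>The kernel is bilinear in \<open>f\<close> and \<open>h\<close>, so dividing by
  \<open>c\<close> and \<open>d\<close> reduces the claim to norms at most 1. For finite
  \<open>r\<close>, Jensen's inequality in \<open>y\<close> leads to the double integral; for
  infinite \<open>r\<close> the kernel is bounded by 1 almost everywhere.\<close>

lemma (in prob_space) Lp_norm_integral_leibniz_kernel_le:
  assumes pqr: "1 \<le> p" "1 \<le> q" "1 \<le> r" "1 / r = 1 / p + 1 / q" and cd: "0 < c" "0 < d"
    and int: "integrable M f" "integrable M h" "integrable M (\<lambda>x. f x * h x)"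
    and le: "Lp_norm M p f \<le> ennreal c" "Lp_norm M q h \<le> ennreal d"
  shows "Lp_norm M r (\<lambda>x. \<integral>y. leibniz_kernel f h x y \<partial>M) \<le> ennreal (c * d)"
proof -
  note [measurable] = int[THEN borel_measurable_integrable]
  let ?f = "\<lambda>x. f x / c" and ?h = "\<lambda>x. h x / d"
  have kernel: "leibniz_kernel f h x y / (c * d) = leibniz_kernel ?f ?h x y" for x y
    using cd by (simp add: leibniz_kernel_def field_simps)
  have T: "(\<integral>y. leibniz_kernel f h x y \<partial>M) / (c * d) = (\<integral>y. leibniz_kernel ?f ?h x y \<partial>M)" for x
    by (simp flip: kernel)
  have int': "integrable M (leibniz_kernel ?f ?h x)" for x
    using int by (intro integrable_leibniz_kernel) (auto simp: finite_measure_axioms)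
  have le': "Lp_norm M p ?f \<le> 1" "Lp_norm M q ?h \<le> 1"
    using le pqr cd by (simp_all add: Lp_norm_le_iff_scaled)
  from pqr(3) show ?thesis
  proof (cases rule: ennreal_ge_1_cases)
    case 1
    \<comment> \<open>Now \<open>1 / p + 1 / q\<close> vanishes, so both exponents are
      infinite.\<close>
    then have [simp]: "p = \<infinity>" "q = \<infinity>"
      using pqr by (auto elim!: ennreal_ge_1_cases)
    have f: "AE x in M. \<bar>?f x\<bar> \<le> 1" and h: "AE x in M. \<bar>?h x\<bar> \<le> 1"
      using le' Lp_norm_infinity_le_iff[of 1 ?f M] Lp_norm_infinity_le_iff[of 1 ?h M] by simp_all
    have "AE x in M. \<bar>\<integral>y. leibniz_kernel ?f ?h x y \<partial>M\<bar> \<le> 1"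
      using f h
    proof eventually_elim
      case (elim x)
      have "AE y in M. \<bar>leibniz_kernel ?f ?h x y\<bar> \<le> 1"
        using f h
      proof eventually_elim
        case (elim y)
        show ?case
          using half_sum_diff_le[of "?f x" 1 "?f y" "?h x" 1 "?h y"] elim \<open>\<bar>?f x\<bar> \<le> 1\<close> \<open>\<bar>?h x\<bar> \<le> 1\<close>
          by (simp add: leibniz_kernel_def)
      qed
      then have "expectation (\<lambda>y. \<bar>leibniz_kernel ?f ?h x y\<bar>) \<le> 1"
        using int' by (intro integral_le_const) auto
      then show ?case
        using integral_abs_bound[of M "leibniz_kernel ?f ?h x"] by linarith
    qed
    then have "AE x in M. \<bar>\<integral>y. leibniz_kernel f h x y \<partial>M\<bar> \<le> c * d"
      using cd by (simp add: abs_mult abs_divide flip: T)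
    then show ?thesis
      using 1 cd Lp_norm_infinity_le_iff[of "c * d" "\<lambda>x. \<integral>y. leibniz_kernel f h x y \<partial>M" M]
      by simp
  next
    case (2 R)
    have "(\<integral>\<^sup>+ x. ennreal (\<bar>(\<integral>y. leibniz_kernel f h x y \<partial>M) / (c * d)\<bar> powr R) \<partial>M)
      \<le> (\<integral>\<^sup>+ x. \<integral>\<^sup>+ y. ennreal (\<bar>leibniz_kernel ?f ?h x y\<bar> powr R) \<partial>M \<partial>M)"
      unfolding T using 2 int' by (intro nn_integral_mono expectation_powr_le_nn_integral)
    also have "\<dots> \<le> 1"
      using pqr 2 le' by (intro nn_integral_leibniz_kernel_powr_le_1[of p q]) auto
    finally show ?thesis using 2 cd by (simp add: Lp_norm_finite_le_iff)
  qed
qed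

section \<open>Essentially bounded functions and the final estimate\<close>

lemma Lp_space_infinityE:
  assumes "f \<in> Lp_space M \<infinity>"
  obtains C where "0 < C" "AE x in M. \<bar>f x\<bar> \<le> C" "f \<in> borel_measurable M"
proof -
  from assms have f: "f \<in> borel_measurable M" "Lp_norm M \<infinity> f < \<infinity>" by (auto simp: Lp_space_def)
  then obtain c where c: "0 \<le> c" "Lp_norm M \<infinity> f = ennreal c"
    by (cases "Lp_norm M \<infinity> f") auto
  then have "AE x in M. \<bar>f x\<bar> \<le> c"
    using f Lp_norm_infinity_le_iff[of c f M] by simp
  \<comment> \<open>The essential supremum may be 0; adding 1 gives a strictly positive
    bound.\<close>
  then have "AE x in M. \<bar>f x\<bar> \<le> c + 1" by (auto elim: eventually_mono)
  then show ?thesis using that[of "c + 1"] c f by auto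
qed

text \<open>On a probability space bounded functions have finite norm for every exponent. Hence the
  four norms on the right of the theorem are real numbers, and the final limit is one of real
  expressions.\<close>

lemma (in prob_space) Lp_norm_of_AE_bounded_finite:
  assumes "1 \<le> p" "f \<in> borel_measurable M" "AE x in M. \<bar>f x\<bar> \<le> C"
  obtains c where "0 \<le> c" "Lp_norm M p f = ennreal c"
proof -
  have "AE x in M. \<bar>f x\<bar> \<le> \<bar>C\<bar> + 1" using assms(3) by (auto elim: eventually_mono)
  then have "Lp_norm M p f \<le> ennreal (\<bar>C\<bar> + 1)"
    using assms by (intro Lp_norm_le_of_AE_bounded) auto
  then show ?thesis using that by (cases "Lp_norm M p f") (auto simp: top_unique)
qed

theorem theorem1:
  fixes M :: "'a measure" and r p1 p2 q1 q2 :: ennreal and f g :: "'a \<Rightarrow> real"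
  assumes "prob_space M"
    and "1 \<le> r" "1 \<le> p1" "1 \<le> p2" "1 \<le> q1" "1 \<le> q2"
    and "1 / r = 1 / p1 + 1 / q1" "1 / r = 1 / p2 + 1 / q2"
    and "f \<in> Lp_space M \<infinity>" "g \<in> Lp_space M \<infinity>"
  shows "Lp_norm M r (\<lambda>x. f x * g x - (\<integral>y. f y * g y \<partial>M))
    \<le> Lp_norm M p1 f * Lp_norm M q1 (\<lambda>x. g x - (\<integral>y. g y \<partial>M))
      + Lp_norm M p2 g * Lp_norm M q2 (\<lambda>x. f x - (\<integral>y. f y \<partial>M))"
proof -
  interpret prob_space M by fact
  obtain C D where C: "0 < C" "AE x in M. \<bar>f x\<bar> \<le> C" and D: "0 < D" "AE x in M. \<bar>g x\<bar> \<le> D"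
    and [measurable]: "f \<in> borel_measurable M" "g \<in> borel_measurable M"
    using assms(9,10) by (metis Lp_space_infinityE)
  define F where "F = (\<lambda>x. f x - expectation f)"
  define G where "G = (\<lambda>x. g x - expectation g)"
  have [measurable]: "F \<in> borel_measurable M" "G \<in> borel_measurable M"
    unfolding F_def G_def by measurable
  have F_bnd: "AE x in M. \<bar>F x\<bar> \<le> C + \<bar>expectation f\<bar>"
    using C(2) by eventually_elim (auto simp: F_def)
  have G_bnd: "AE x in M. \<bar>G x\<bar> \<le> D + \<bar>expectation g\<bar>"
    using D(2) by eventually_elim (auto simp: G_def)
  have fg_bnd: "AE x in M. \<bar>f x * g x\<bar> \<le> C * D"
    using C(2) D(2) by eventually_elim (auto simp: abs_mult intro!: mult_mono)
  have [simp]: "integrable M f" "integrable M g" "integrable M (\<lambda>x. f x * g x)"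
    using integrable_const_bound[of f C] integrable_const_bound[of g D]
      integrable_const_bound[of "\<lambda>x. f x * g x" "C * D"] C(2) D(2) fg_bnd by simp_all
  have [simp]: "integrable M F" "integrable M G" "expectation F = 0" "expectation G = 0"
    by (simp_all add: F_def G_def prob_space)
  have fG: "(\<lambda>x. f x * G x) = (\<lambda>x. f x * g x - f x * expectation g)"
    and gF: "(\<lambda>x. g x * F x) = (\<lambda>x. f x * g x - g x * expectation f)"
    by (auto simp: F_def G_def algebra_simps)
  have [simp]: "integrable M (\<lambda>x. f x * G x)" "integrable M (\<lambda>x. g x * F x)"
    by (simp_all add: fG gF)
  \<comment> \<open>Each integral is half of
    \<open>f x * g x - expectation (\<lambda>y. f y * g y)\<close> plus or minus half of
    \<open>g x * expectation f - f x * expectation g\<close>; the latter cancels in the sum.\<close>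
  have decomp: "f x * g x - expectation (\<lambda>y. f y * g y) =
      (\<integral>y. leibniz_kernel f G x y \<partial>M) + (\<integral>y. leibniz_kernel g F x y \<partial>M)" for x
    by (simp add: integral_leibniz_kernel fG gF) (simp add: F_def G_def field_simps)
  \<comment> \<open>The bounds on the kernel integrals need positive constants, so the norms, which may vanish,
    are enlarged by \<open>e\<close> and \<open>e\<close> tends to \<open>0\<close>.\<close>
  obtain a where a: "0 \<le> a" "Lp_norm M p1 f = ennreal a"
    using Lp_norm_of_AE_bounded_finite[OF assms(3) _ C(2)] by auto
  obtain b where b: "0 \<le> b" "Lp_norm M q1 G = ennreal b"
    using Lp_norm_of_AE_bounded_finite[OF assms(5) _ G_bnd] by auto
  obtain c where c: "0 \<le> c" "Lp_norm M p2 g = ennreal c"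
    using Lp_norm_of_AE_bounded_finite[OF assms(4) _ D(2)] by auto
  obtain d where d: "0 \<le> d" "Lp_norm M q2 F = ennreal d"
    using Lp_norm_of_AE_bounded_finite[OF assms(6) _ F_bnd] by auto
  note nonneg = a(1) b(1) c(1) d(1) and norms = a(2) b(2) c(2) d(2)
  let ?N = "Lp_norm M r (\<lambda>x. f x * g x - expectation (\<lambda>y. f y * g y))"
  let ?B = "\<lambda>e. (a + e) * (b + e) + (c + e) * (d + e)"
  have le: "?N \<le> ennreal (?B e)" if "0 < e" for e
  proof -
    have "Lp_norm M r (\<lambda>x. \<integral>y. leibniz_kernel f G x y \<partial>M) \<le> ennreal ((a + e) * (b + e))"
      using that nonneg
      by (intro Lp_norm_integral_leibniz_kernel_le[OF assms(3,5,2,7)]) (auto simp: norms intro: ennreal_leI)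
    moreover have "Lp_norm M r (\<lambda>x. \<integral>y. leibniz_kernel g F x y \<partial>M) \<le> ennreal ((c + e) * (d + e))"
      using that nonneg
      by (intro Lp_norm_integral_leibniz_kernel_le[OF assms(4,6,2,8)]) (auto simp: norms intro: ennreal_leI)
    ultimately show ?thesis
      unfolding decomp using assms(2) that nonneg
      by (intro Lp_norm_add_le) auto
  qed
  have "((\<lambda>e. ennreal (?B e)) \<longlongrightarrow> ennreal (?B 0)) (at_right 0)"
    by (intro tendsto_intros tendsto_ennrealI)
  moreover have "\<forall>\<^sub>F e in at_right 0. ?N \<le> ennreal (?B e)"
    using eventually_at_right_less[of "0::real"] by eventually_elim (rule le)
  ultimately have "?N \<le> ennreal (?B 0)"
    by (intro tendsto_lowerbound) auto
  then show ?thesis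
    unfolding F_def[symmetric] G_def[symmetric] norms using nonneg
    by (simp add: ennreal_plus ennreal_mult)
qed

end
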